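(* Let $q$ be a prime power, $n$ a positive integer, and let $V_1$ and $V_2$ be two distinct Sidon spaces in $\mathbb{F}_{q^n}$ with $\dim_{\mathbb{F}_q}V_1=k_1$ and $\dim_{\mathbb{F}_q}V_2=k_2$. Suppose that $$\dim_{\mathbb{F}_q}(V_1\cap\alpha V_2)\le 1\quad\text{for each }\alpha\in\mathbb{F}_{q^n}^*.$$ Let $m$ be a multiple of $n$ such that $\frac{m}{n}>2$, and let $\delta$ be a root of an irreducible polynomial over $\mathbb{F}_{q^n}$ of degree $\frac{m}{n}$ (so $\mathbb{F}_{q^n}(\delta)=\mathbb{F}_{q^m}$). Then $$V=\{v_1+\delta v_2 : v_1\in V_1,\ v_2\in V_2\}$$ is a Sidon space in $\mathbb{F}_{q^m}$ of dimension $k_1+k_2$ over $\mathbb{F}_q$.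
   Context: An $\mathbb{F}_q$-subspace $V$ of a finite extension field of $\mathbb{F}_{q}$ is a Sidon space if for all nonzero $a,b,c,d\in V$ with $ab=cd$ one has $\{a\mathbb{F}_q,b\mathbb{F}_q\}=\{c\mathbb{F}_q,d\mathbb{F}_q\}$, where $e\mathbb{F}_q=\{e\lambda:\lambda\in\mathbb{F}_q\}$. Here $\alpha V_2=\{\alpha v: v\in V_2\}$. *)

theory Defs
  imports "HOL-Algebra.Finite_Extensions" "HOL-Number_Theory.Prime_Powers"
begin

text \<open>
  The scalar field is a subfield K of the ambient field R. Despite its name, the
  library's \<open>subalgebra K V R\<close> says that V is a K-subspace of R (no closure under
  multiplication is required), and the left coset \<open>a <#\<^bsub>R\<^esub> K\<close> is the set of all
  products of a with an element of K.
\<close>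

definition sidon_space :: "('a, 'b) ring_scheme \<Rightarrow> 'a set \<Rightarrow> 'a set \<Rightarrow> bool" where
  "sidon_space R K V \<longleftrightarrow>
     subalgebra K V R \<and>
     (\<forall>a \<in> V - {\<zero>\<^bsub>R\<^esub>}. \<forall>b \<in> V - {\<zero>\<^bsub>R\<^esub>}. \<forall>c \<in> V - {\<zero>\<^bsub>R\<^esub>}. \<forall>d \<in> V - {\<zero>\<^bsub>R\<^esub>}.
        a \<otimes>\<^bsub>R\<^esub> b = c \<otimes>\<^bsub>R\<^esub> d \<longrightarrow>
        {a <#\<^bsub>R\<^esub> K, b <#\<^bsub>R\<^esub> K} = {c <#\<^bsub>R\<^esub> K, d <#\<^bsub>R\<^esub> K})"

end

theory Submission
  imports Defs
begin

text \<open>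
  Since \<open>1\<close>, \<open>\<delta>\<close>, \<open>\<delta>\<^sup>2\<close> are linearly independent over \<open>F\<close>, an equation \<open>a b = c d\<close> in \<open>V\<close>
  is an identity between products of linear forms over \<open>F\<close>. By unique factorization we may assume
  \<open>c = \<alpha> a\<close> and \<open>b = \<alpha> d\<close> with \<open>\<alpha> \<in> F\<close>, and these hold for both components. If some \<open>V1\<close>-component
  \<open>x\<close> and some \<open>V2\<close>-component \<open>y\<close> of \<open>a\<close> or \<open>d\<close> are nonzero, then \<open>V1 \<inter> (x/y) V2\<close> contains \<open>x\<close>
  and \<open>\<alpha> x\<close>, so the dimension bound forces \<open>\<alpha> \<in> K\<close>. Otherwise all four elements lie in \<open>V1\<close>, or all
  lie in \<open>\<delta> V2\<close>, and the Sidon property of \<open>V1\<close> or \<open>V2\<close> applies.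
\<close>

section \<open>Independence of 1, \<delta>, \<delta>^2 over F\<close>

text \<open>The kernel of evaluation at \<open>x\<close> is generated by \<open>Irr F x\<close>. The
  irreducible \<open>p\<close> lies in it and is therefore associated to \<open>Irr F x\<close>,
  which divides every \<open>q\<close> vanishing at \<open>x\<close>.\<close>

lemma (in domain) degree_le_of_pirreducible_root:
  assumes F: "subfield F R" and p: "p \<in> carrier (F[X])" "pirreducible F p"
    and x: "x \<in> carrier R" "eval p x = \<zero>"
    and q: "q \<in> carrier (F[X])" "q \<noteq> []" "eval q x = \<zero>"
  shows "Polynomials.degree p \<le> Polynomials.degree q"
proof -
  have F': "subring F R" using subfieldE(1)[OF F] .
  have alg: "(algebraic over F) x"
    using algebraicI[OF q(1,2,3)] .
  note Irr = IrrE[OF F x(1) alg]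
  have nz: "Irr F x \<noteq> []"
    using Irr(2) unfolding ring_irreducible_def univ_poly_zero by auto
  have "p \<in> PIdl\<^bsub>F[X]\<^esub> (Irr F x)"
    using Irr_generates_ker[OF F x(1) alg] p(1) x(2) unfolding a_kernel_def' by auto
  hence "Irr F x \<sim>\<^bsub>F[X]\<^esub> p"
    using cgenideal_pirreducible[OF F Irr(1,2) p(2)] by simp
  hence "p divides\<^bsub>F[X]\<^esub> Irr F x"
    unfolding associated_def by simp
  hence "p pdivides Irr F x"
    using pdivides_iff_shell[OF F p(1) Irr(1)] by simp
  hence "Polynomials.degree p \<le> Polynomials.degree (Irr F x)"
    using pdivides_imp_degree_le[OF F' p(1) Irr(1) nz] by simp
  also have "\<dots> \<le> Polynomials.degree q"
    using pdivides_imp_degree_le[OF F' Irr(1) q(1,2)] Irr_minimal[OF F x(1) alg q(1,3)] by simp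
  finally show ?thesis .
qed

lemma (in domain) quadratic_independent_of_pirreducible_root:
  assumes F: "subfield F R" and p: "p \<in> carrier (F[X])" "pirreducible F p"
    and x: "x \<in> carrier R" "eval p x = \<zero>" and deg: "Polynomials.degree p > 2"
    and u: "u \<in> F" "v \<in> F" "w \<in> F"
    and eq: "u \<oplus> (x \<otimes> v \<oplus> x \<otimes> (x \<otimes> w)) = \<zero>"
  shows "u = \<zero> \<and> v = \<zero> \<and> w = \<zero>"
proof -
  have c: "u \<in> carrier R" "v \<in> carrier R" "w \<in> carrier R"
    using u subfieldE(3)[OF F] by auto
  have small: "q = []" if "q \<in> carrier (F[X])" "eval q x = \<zero>" "Polynomials.degree q \<le> 2" for q
    using degree_le_of_pirreducible_root[OF F p x that(1) _ that(2)] that(3) deg by fastforce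
  \<comment> \<open>Polynomials are coefficient lists with a nonzero leading entry, so
    \<open>w\<close> is eliminated first, then \<open>v\<close>; the relation itself then gives
    \<open>u\<close>.\<close>
  have w0: "w = \<zero>"
  proof (rule ccontr)
    assume "w \<noteq> \<zero>"
    hence "[w, v, u] \<in> carrier (F[X])"
      using u unfolding sym[OF univ_poly_carrier] polynomial_def by auto
    moreover have "eval [w, v, u] x = u \<oplus> (x \<otimes> v \<oplus> x \<otimes> (x \<otimes> w))"
      using c x(1) by (simp add: numeral_2_eq_2 a_ac m_ac)
    ultimately show False using small[of "[w, v, u]"] eq by simp
  qed
  have v0: "v = \<zero>"
  proof (rule ccontr)
    assume "v \<noteq> \<zero>"
    hence "[v, u] \<in> carrier (F[X])"
      using u unfolding sym[OF univ_poly_carrier] polynomial_def by auto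
    moreover have "eval [v, u] x = u \<oplus> (x \<otimes> v \<oplus> x \<otimes> (x \<otimes> w))"
      using c x(1) w0 by (simp add: a_ac m_ac)
    ultimately show False using small[of "[v, u]"] eq by simp
  qed
  show ?thesis using eq v0 w0 c x(1) by simp
qed

section \<open>Auxiliary algebra: dimensions, linear forms, cosets\<close>

lemma (in ring) line_of_dimension_le_one:
  assumes K: "subfield K R" and "dimension d K W" "d \<le> 1"
    and u: "u \<in> W" "u \<noteq> \<zero>" and v: "v \<in> W"
  shows "\<exists>k \<in> K. v = k \<otimes> u"
proof -
  have "W \<noteq> {\<zero>}" using u by auto
  hence "d = Suc 0"
    using dimension_zero[OF K] assms(2,3) by (cases d) auto
  then obtain e where e: "e \<in> carrier R" "W = line_extension K e {\<zero>}"
    using dimension_backwards[OF K, of 0 W] dimension_zero[OF K] assms(2) by blast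
  have Kc: "K \<subseteq> carrier R" using subfieldE(3)[OF K] .
  obtain k l where k: "k \<in> K" "u = k \<otimes> e" and l: "l \<in> K" "v = l \<otimes> e"
    using u(1) v Kc e(1) unfolding e(2) line_extension_mem_iff by (auto simp: subset_iff)
  have "k \<in> K - {\<zero>}" using u(2) k e(1) by auto
  note k' = subfield_m_inv[OF K this]
  have "k \<in> carrier R" "l \<in> carrier R" "inv k \<in> carrier R"
    using k(1) l(1) k'(1) Kc by auto
  \<comment> \<open>With \<open>u = k e\<close> and \<open>v = l e\<close> the multiplier is
    \<open>l / k\<close>. Associativity alone yields it, as this holds in any ring.\<close>
  hence "(l \<otimes> inv k) \<otimes> u = l \<otimes> ((inv k \<otimes> k) \<otimes> e)"
    unfolding k(2) using e(1) by (simp only: m_assoc m_closed)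
  hence "v = (l \<otimes> inv k) \<otimes> u"
    using l k'(3) e(1) by simp
  moreover have "l \<otimes> inv k \<in> K"
    using l(1) k'(1) subringE(6)[OF subfieldE(1)[OF K]] by auto
  ultimately show ?thesis by blast
qed

text \<open>Multiplication by a nonzero \<open>d\<close> is injective and K-linear, so it carries
  each step in the construction of \<open>E\<close> to a step in the construction of
  \<open>d E\<close>.\<close>

lemma (in domain) dimension_l_coset:
  assumes K: "subfield K R" and d: "d \<in> carrier R" "d \<noteq> \<zero>" and "dimension n K E"
  shows "dimension n K (d <# E)"
  using assms(4) K
proof (induct rule: dimension.induct)
  case (zero_dim K)
  show ?case using d(1) by (simp add: l_coset_def)
next
  case (Suc_dim v E n K)
  have E: "E \<subseteq> carrier R" using space_subgroup_props(1)[OF Suc_dim(5,3)] .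
  have Kc: "K \<subseteq> carrier R" using subfieldE(3)[OF Suc_dim(5)] .
  have "d \<otimes> v \<notin> d <# E"
    using Suc_dim(1,2) E d m_lcancel unfolding l_coset_def by auto
  hence "dimension (Suc n) K (line_extension K (d \<otimes> v) (d <# E))"
    using dimension.Suc_dim[OF _ _ Suc_dim(4)[OF Suc_dim(5)]] d(1) Suc_dim(1) by simp
  moreover have "d <# line_extension K v E = line_extension K (d \<otimes> v) (d <# E)"
  proof -
    have eq: "d \<otimes> (k \<otimes> v \<oplus> e) = k \<otimes> (d \<otimes> v) \<oplus> d \<otimes> e" if "k \<in> K" "e \<in> E" for k e
    proof -
      have "k \<in> carrier R" "e \<in> carrier R" using that Kc E by auto
      thus ?thesis using d(1) Suc_dim(1) by (simp add: r_distr m_lcomm)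
    qed
    show ?thesis
    proof (intro Set.set_eqI iffI)
      fix x assume "x \<in> d <# line_extension K v E"
      then obtain k e where "k \<in> K" "e \<in> E" "x = d \<otimes> (k \<otimes> v \<oplus> e)"
        by (auto simp: l_coset_def line_extension_mem_iff)
      thus "x \<in> line_extension K (d \<otimes> v) (d <# E)"
        using eq by (auto simp: l_coset_def line_extension_mem_iff)
    next
      fix x assume "x \<in> line_extension K (d \<otimes> v) (d <# E)"
      then obtain k e where ke: "k \<in> K" "e \<in> E" "x = k \<otimes> (d \<otimes> v) \<oplus> d \<otimes> e"
        by (auto simp: l_coset_def line_extension_mem_iff)
      hence "x = d \<otimes> (k \<otimes> v \<oplus> e)" using eq by simp
      moreover have "k \<otimes> v \<oplus> e \<in> line_extension K v E"
        using ke unfolding line_extension_mem_iff by auto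
      ultimately show "x \<in> d <# line_extension K v E"
        unfolding l_coset_def by auto
    qed
  qed
  ultimately show ?case by simp
qed

text \<open>The product of the linear forms \<open>a1 + a2 X\<close> and \<open>b1 + b2 X\<close>, homogenized, vanishes at the
  root of \<open>c1 + c2 X\<close>.\<close>

lemma (in domain) proportional_of_product_eq:
  assumes c: "a1 \<in> carrier R" "a2 \<in> carrier R" "b1 \<in> carrier R" "b2 \<in> carrier R"
      "c1 \<in> carrier R" "c2 \<in> carrier R" "d1 \<in> carrier R" "d2 \<in> carrier R"
    and e0: "a1 \<otimes> b1 = c1 \<otimes> d1"
    and e1: "a1 \<otimes> b2 \<oplus> a2 \<otimes> b1 = c1 \<otimes> d2 \<oplus> c2 \<otimes> d1"
    and e2: "a2 \<otimes> b2 = c2 \<otimes> d2"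
  shows "a1 \<otimes> c2 = a2 \<otimes> c1 \<or> b1 \<otimes> c2 = b2 \<otimes> c1"
proof -
  \<comment> \<open>The right-hand side involves only the coefficients of the product of the forms,
    so those of the other factorization can be substituted. The homogenized evaluation also covers
    \<open>c2 = 0\<close>.\<close>
  have "(a1 \<otimes> c2 \<ominus> a2 \<otimes> c1) \<otimes> (b1 \<otimes> c2 \<ominus> b2 \<otimes> c1)
      = (a1 \<otimes> b1) \<otimes> (c2 \<otimes> c2) \<oplus> (a2 \<otimes> b2) \<otimes> (c1 \<otimes> c1)
        \<ominus> (a1 \<otimes> b2 \<oplus> a2 \<otimes> b1) \<otimes> (c1 \<otimes> c2)"
    using c by algebra
  also have "\<dots> = \<zero>"
    unfolding e0 e1 e2 using c by algebra
  finally have "a1 \<otimes> c2 \<ominus> a2 \<otimes> c1 = \<zero> \<or> b1 \<otimes> c2 \<ominus> b2 \<otimes> c1 = \<zero>"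
    using c by (simp add: integral_iff)
  thus ?thesis using c by simp
qed


text \<open>Multiplication by a nonzero scalar permutes \<open>K\<close>; its inverse gives the
  second inclusion.\<close>

lemma (in field) l_coset_mult_eq:
  assumes K: "subfield K R" and k: "k \<in> K - {\<zero>}" and a: "a \<in> carrier R"
  shows "(k \<otimes> a) <# K = a <# K"
proof -
  have Kc: "K \<subseteq> carrier R" using subfieldE(3)[OF K] .
  note k' = subfield_m_inv[OF K k]
  have cl: "x \<otimes> y \<in> K" if "x \<in> K" "y \<in> K" for x y
    using that subringE(6)[OF subfieldE(1)[OF K]] by auto
  have 1: "(k \<otimes> a) \<otimes> x = a \<otimes> (k \<otimes> x)" if "x \<in> K" for x
    using that k a Kc by (auto simp: m_ac subset_iff)
  have 2: "a \<otimes> x = (k \<otimes> a) \<otimes> (inv k \<otimes> x)" if x: "x \<in> K" for x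
  proof -
    have "(k \<otimes> a) \<otimes> (inv k \<otimes> x) = (k \<otimes> inv k) \<otimes> (a \<otimes> x)"
      using x k k'(1) a Kc by (auto simp: m_ac subset_iff)
    thus ?thesis using k'(2) x a Kc by auto
  qed
  show ?thesis
  proof
    show "(k \<otimes> a) <# K \<subseteq> a <# K"
      using 1 cl k unfolding l_coset_def by auto
    show "a <# K \<subseteq> (k \<otimes> a) <# K"
      using 2 cl k'(1) unfolding l_coset_def by auto
  qed
qed

lemma (in ring) l_coset_assoc:
  assumes "d \<in> carrier R" "a \<in> carrier R" "K \<subseteq> carrier R"
  shows "d <# (a <# K) = (d \<otimes> a) <# K"
proof -
  have "d \<otimes> (a \<otimes> k) = d \<otimes> a \<otimes> k" if "k \<in> K" for k
    using that assms by (auto simp: m_assoc)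
  thus ?thesis unfolding l_coset_def by auto
qed

lemma sidon_spaceD:
  assumes "sidon_space R K V"
    and "a \<in> V - {\<zero>\<^bsub>R\<^esub>}" "b \<in> V - {\<zero>\<^bsub>R\<^esub>}" "c \<in> V - {\<zero>\<^bsub>R\<^esub>}" "d \<in> V - {\<zero>\<^bsub>R\<^esub>}"
    and "a \<otimes>\<^bsub>R\<^esub> b = c \<otimes>\<^bsub>R\<^esub> d"
  shows "{a <#\<^bsub>R\<^esub> K, b <#\<^bsub>R\<^esub> K} = {c <#\<^bsub>R\<^esub> K, d <#\<^bsub>R\<^esub> K}"
  using assms unfolding sidon_space_def by meson

section \<open>The two Sidon spaces and coordinates with respect to \<delta>\<close>

text \<open>The irreducible polynomial is represented here by its consequence \<open>indep\<close>,
  the form in which products of two elements of \<open>W\<close> are compared.\<close>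

locale sidon_pair = field R for R (structure) +
  fixes K F V1 V2 \<delta>
  assumes K: "subfield K R" and F: "subfield F R"
    and V1: "sidon_space R K V1" "V1 \<subseteq> F"
    and V2: "sidon_space R K V2" "V2 \<subseteq> F"
    and inter: "\<forall>\<alpha> \<in> F - {\<zero>}. \<exists>d \<le> 1. dimension d K (V1 \<inter> (\<alpha> <# V2))"
    and delta [simp]: "\<delta> \<in> carrier R"
    and indep: "\<lbrakk>u \<in> F; v \<in> F; w \<in> F; u \<oplus> (\<delta> \<otimes> v \<oplus> \<delta> \<otimes> (\<delta> \<otimes> w)) = \<zero>\<rbrakk>
      \<Longrightarrow> u = \<zero> \<and> v = \<zero> \<and> w = \<zero>"
begin

definition W :: "'a set" where
  "W = {v1 \<oplus> \<delta> \<otimes> v2 | v1 v2. v1 \<in> V1 \<and> v2 \<in> V2}"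

lemma F_carrier: "x \<in> F \<Longrightarrow> x \<in> carrier R"
  using subfieldE(3)[OF F] by blast

lemma F_closed:
  "\<zero> \<in> F"
  "\<lbrakk>x \<in> F; y \<in> F\<rbrakk> \<Longrightarrow> x \<oplus> y \<in> F"
  "\<lbrakk>x \<in> F; y \<in> F\<rbrakk> \<Longrightarrow> x \<ominus> y \<in> F"
  "\<lbrakk>x \<in> F; y \<in> F\<rbrakk> \<Longrightarrow> x \<otimes> y \<in> F"
  "x \<in> F - {\<zero>} \<Longrightarrow> inv x \<in> F"
  using subringE[OF subfieldE(1)[OF F]] subfield_m_inv[OF F, of x]
  by (auto simp: a_minus_def)

lemma V1_F: "x \<in> V1 \<Longrightarrow> x \<in> F" and V2_F: "x \<in> V2 \<Longrightarrow> x \<in> F"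
  using V1 V2 by auto

lemma V_subalgebra: "subalgebra K V1 R" "subalgebra K V2 R"
  using V1 V2 unfolding sidon_space_def by auto

lemma V_zero: "\<zero> \<in> V1" "\<zero> \<in> V2"
  using subgroup.one_closed[OF subalgebra.axioms(1)[OF V_subalgebra(1)]]
    subgroup.one_closed[OF subalgebra.axioms(1)[OF V_subalgebra(2)]] by auto

text \<open>The difference of the two sides is a vanishing combination of 1, \<delta>, \<delta>^2
  with coefficients in \<open>F\<close>, to which \<open>indep\<close> applies.\<close>

lemma quadratic_unique:
  assumes "u \<in> F" "v \<in> F" "w \<in> F" "u' \<in> F" "v' \<in> F" "w' \<in> F"
    and eq: "u \<oplus> (\<delta> \<otimes> v \<oplus> \<delta> \<otimes> (\<delta> \<otimes> w)) = u' \<oplus> (\<delta> \<otimes> v' \<oplus> \<delta> \<otimes> (\<delta> \<otimes> w'))"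
  shows "u = u' \<and> v = v' \<and> w = w'"
proof -
  note c = assms(1-6)[THEN F_carrier]
  have "(u \<ominus> u') \<oplus> (\<delta> \<otimes> (v \<ominus> v') \<oplus> \<delta> \<otimes> (\<delta> \<otimes> (w \<ominus> w')))
      = (u \<oplus> (\<delta> \<otimes> v \<oplus> \<delta> \<otimes> (\<delta> \<otimes> w))) \<ominus> (u' \<oplus> (\<delta> \<otimes> v' \<oplus> \<delta> \<otimes> (\<delta> \<otimes> w')))"
    using c delta by algebra
  also have "\<dots> = \<zero>" unfolding eq using c by simp
  finally have "u \<ominus> u' = \<zero> \<and> v \<ominus> v' = \<zero> \<and> w \<ominus> w' = \<zero>"
    using indep[of "u \<ominus> u'" "v \<ominus> v'" "w \<ominus> w'"] assms(1-6) F_closed by simp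
  thus ?thesis using c by simp
qed

lemma linear_unique:
  assumes "u \<in> F" "v \<in> F" "u' \<in> F" "v' \<in> F"
    and "u \<oplus> \<delta> \<otimes> v = u' \<oplus> \<delta> \<otimes> v'"
  shows "u = u' \<and> v = v'"
  using quadratic_unique[of u v \<zero> u' v' \<zero>] assms F_closed(1) F_carrier by simp

lemma delta_nonzero: "\<delta> \<noteq> \<zero>"
proof
  assume "\<delta> = \<zero>"
  moreover have "\<one> \<in> F" using subringE(3)[OF subfieldE(1)[OF F]] .
  ultimately show False
    using linear_unique[of \<zero> \<one> \<zero> \<zero>] F_closed(1) by simp
qed

text \<open>This is where the bound on the intersections enters. For \<open>g = x / y\<close> both
  \<open>x = g y\<close> and \<open>\<alpha> x = g (\<alpha> y)\<close> lie in the intersection of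
  \<open>V1\<close> with \<open>g V2\<close>, which is at most a line over \<open>K\<close>.\<close>

lemma common_multiplier_in_K:
  assumes a: "\<alpha> \<in> F" and x: "x \<in> V1" "\<alpha> \<otimes> x \<in> V1" "x \<noteq> \<zero>"
    and y: "y \<in> V2" "\<alpha> \<otimes> y \<in> V2" "y \<noteq> \<zero>"
  shows "\<alpha> \<in> K"
proof -
  have xF: "x \<in> F" and yF: "y \<in> F" using x(1) y(1) V1_F V2_F by auto
  note c [simp] = F_carrier[OF a] F_carrier[OF xF] F_carrier[OF yF]
  have iy [simp]: "inv y \<in> carrier R" "inv y \<noteq> \<zero>" "inv y \<otimes> y = \<one>"
    using subfield_m_inv[OF F, of y] yF y(3) F_carrier by auto
  define g where "g = x \<otimes> inv y"
  have g: "g \<in> F" "g \<noteq> \<zero>"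
    using F_closed yF xF y(3) x(3) by (auto simp: g_def integral_iff)
  have gy: "g \<otimes> y = x"
    by (simp add: g_def m_assoc)
  have "g \<otimes> (\<alpha> \<otimes> y) = \<alpha> \<otimes> x"
    using gy F_carrier[OF g(1)] m_lcomm[of g \<alpha> y] by simp
  hence "x \<in> V1 \<inter> (g <# V2)" "\<alpha> \<otimes> x \<in> V1 \<inter> (g <# V2)"
    using x y gy unfolding l_coset_def by force+
  moreover obtain d where "d \<le> 1" "dimension d K (V1 \<inter> (g <# V2))"
    using inter g by blast
  ultimately obtain k where k: "k \<in> K" "\<alpha> \<otimes> x = k \<otimes> x"
    using line_of_dimension_le_one[OF K _ _ _ x(3)] by metis
  moreover have "k \<in> carrier R" using k(1) subfieldE(3)[OF K] by auto
  ultimately show ?thesis using m_rcancel[of x \<alpha> k] x(3) by simp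
qed

section \<open>Comparing two factorizations in \<open>W\<close>\<close>

lemma W_components:
  assumes "a \<in> W"
  obtains a1 a2 where "a1 \<in> V1" "a2 \<in> V2" "a = a1 \<oplus> \<delta> \<otimes> a2"
  using assms unfolding W_def by blast

text \<open>A vanishing determinant makes two nonzero coordinate vectors proportional. The
  multiplier is \<open>w1 / u1\<close>, or \<open>w2 / u2\<close> when
  \<open>u1 = \<zero>\<close>.\<close>

lemma scaled_components:
  assumes u: "u1 \<in> F" "u2 \<in> F" and w: "w1 \<in> F" "w2 \<in> F"
    and nz: "u1 \<oplus> \<delta> \<otimes> u2 \<noteq> \<zero>" "w1 \<oplus> \<delta> \<otimes> w2 \<noteq> \<zero>" and ratio: "u1 \<otimes> w2 = u2 \<otimes> w1"
  shows "\<exists>\<alpha> \<in> F - {\<zero>}. w1 = \<alpha> \<otimes> u1 \<and> w2 = \<alpha> \<otimes> u2"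
proof -
  note c [simp] = u[THEN F_carrier] w[THEN F_carrier]
  \<comment> \<open>Stated for generic letters so that it serves both cases, with the two
    coordinates exchanged.\<close>
  have key: "y = (x' \<otimes> inv x) \<otimes> y' \<and> x' = (x' \<otimes> inv x) \<otimes> x \<and> x' \<otimes> inv x \<in> F"
    if "x \<in> F" "x \<noteq> \<zero>" "x' \<in> F" "y \<in> F" "y' \<in> F" "x \<otimes> y = y' \<otimes> x'" for x x' y y'
  proof -
    have cc [simp]: "x \<in> carrier R" "x' \<in> carrier R" "y \<in> carrier R" "y' \<in> carrier R"
      using that F_carrier by auto
    have i [simp]: "inv x \<in> carrier R" "inv x \<otimes> x = \<one>" using that(2) by (auto simp: field_Units)
    have "(x' \<otimes> inv x) \<otimes> y' = inv x \<otimes> (y' \<otimes> x')" by (simp add: m_ac)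
    also have "\<dots> = (inv x \<otimes> x) \<otimes> y" unfolding that(6)[symmetric] by (simp only: m_assoc cc i(1))
    also have "\<dots> = y" by simp
    finally show ?thesis using that F_closed by (simp add: m_assoc)
  qed
  have "\<exists>\<alpha> \<in> F. w1 = \<alpha> \<otimes> u1 \<and> w2 = \<alpha> \<otimes> u2"
  proof (cases "u1 = \<zero>")
    case False
    thus ?thesis using key[of u1 w1 w2 u2] u w ratio by blast
  next
    case True
    hence "u2 \<noteq> \<zero>" using nz(1) by auto
    moreover have "u2 \<otimes> w1 = u1 \<otimes> w2" using ratio by simp
    ultimately show ?thesis using key[of u2 w2 w1 u1] u w by blast
  qed
  then obtain \<alpha> where \<alpha>: "\<alpha> \<in> F" "w1 = \<alpha> \<otimes> u1" "w2 = \<alpha> \<otimes> u2" by blast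
  moreover have "\<alpha> \<noteq> \<zero>" using \<alpha> nz(2) by auto
  ultimately show ?thesis by blast
qed

text \<open>If the multiplier \<alpha> from \<open>a\<close> to \<open>c\<close> is in
  \<open>K\<close>, the cosets agree in pairs; otherwise the equation descends to one of the two
  Sidon spaces.\<close>

lemma cosets_eq_of_proportional:
  assumes a: "a1 \<in> V1" "a2 \<in> V2" "a = a1 \<oplus> \<delta> \<otimes> a2" "a \<noteq> \<zero>"
    and b: "b1 \<in> V1" "b2 \<in> V2" "b = b1 \<oplus> \<delta> \<otimes> b2" "b \<noteq> \<zero>"
    and c: "c1 \<in> V1" "c2 \<in> V2" "c = c1 \<oplus> \<delta> \<otimes> c2" "c \<noteq> \<zero>"
    and d: "d1 \<in> V1" "d2 \<in> V2" "d = d1 \<oplus> \<delta> \<otimes> d2" "d \<noteq> \<zero>"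
    and eq: "a \<otimes> b = c \<otimes> d" and ratio: "a1 \<otimes> c2 = a2 \<otimes> c1"
  shows "{a <# K, b <# K} = {c <# K, d <# K}"
proof -
  have inF: "a1 \<in> F" "a2 \<in> F" "b1 \<in> F" "b2 \<in> F" "c1 \<in> F" "c2 \<in> F" "d1 \<in> F" "d2 \<in> F"
    using a b c d V1_F V2_F by auto
  note C [simp] = inF[THEN F_carrier]
  have abcd [simp]: "a \<in> carrier R" "b \<in> carrier R" "c \<in> carrier R" "d \<in> carrier R"
    using a b c d by auto
  obtain \<alpha> where \<alpha>: "\<alpha> \<in> F" "\<alpha> \<noteq> \<zero>" "c1 = \<alpha> \<otimes> a1" "c2 = \<alpha> \<otimes> a2"
    using scaled_components[of a1 a2 c1 c2] inF a(3,4) c(3,4) ratio by auto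
  note [simp] = F_carrier[OF \<alpha>(1)]
  have c\<alpha>: "c = \<alpha> \<otimes> a"
    unfolding c(3) a(3) \<alpha>(3,4) by (simp add: r_distr m_lcomm)
  \<comment> \<open>Cancelling \<open>a\<close> shows that the same \<alpha> also relates
    \<open>d\<close> to \<open>b\<close>.\<close>
  have "a \<otimes> b = a \<otimes> (\<alpha> \<otimes> d)"
    using eq unfolding c\<alpha> by (simp add: m_ac)
  hence b\<alpha>: "b = \<alpha> \<otimes> d" using a(4) by (simp add: m_lcancel)
  also have "\<dots> = \<alpha> \<otimes> d1 \<oplus> \<delta> \<otimes> (\<alpha> \<otimes> d2)"
    unfolding d(3) by (simp add: r_distr m_lcomm)
  finally have b\<alpha>': "b1 = \<alpha> \<otimes> d1" "b2 = \<alpha> \<otimes> d2"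
    using linear_unique[of b1 b2 "\<alpha> \<otimes> d1" "\<alpha> \<otimes> d2"] inF \<alpha>(1) F_closed(4) b(3) by auto
  show ?thesis
  proof (cases "\<alpha> \<in> K")
    case True
    hence "c <# K = a <# K" "b <# K = d <# K"
      unfolding c\<alpha> b\<alpha> using l_coset_mult_eq[OF K] \<alpha>(2) by auto
    thus ?thesis by auto
  next
    case False
    \<comment> \<open>Multiplication by \<alpha> sends the components of \<open>a\<close> and
      \<open>d\<close> to those of \<open>c\<close> and \<open>b\<close>, again in \<open>V1\<close>
      and \<open>V2\<close>. One nonzero component of each type would thus put \<alpha> in
      \<open>K\<close>.\<close>
    have "(a1 = \<zero> \<and> d1 = \<zero>) \<or> (a2 = \<zero> \<and> d2 = \<zero>)"
      using False common_multiplier_in_K[OF \<alpha>(1)] a b c d unfolding \<alpha>(3,4) b\<alpha>' by metis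
    thus ?thesis
    proof
      assume "a2 = \<zero> \<and> d2 = \<zero>"
      \<comment> \<open>The second components of \<open>b\<close> and \<open>c\<close> are multiples
        of those of \<open>d\<close> and \<open>a\<close>, hence vanish as well.\<close>
      hence "a = a1" "b = b1" "c = c1" "d = d1"
        using a(3) b(3) c(3) d(3) \<alpha>(4) b\<alpha>'(2) by auto
      hence "a \<in> V1 - {\<zero>}" "b \<in> V1 - {\<zero>}" "c \<in> V1 - {\<zero>}" "d \<in> V1 - {\<zero>}"
        using a(1,4) b(1,4) c(1,4) d(1,4) by simp_all
      thus ?thesis using eq by (rule sidon_spaceD[OF V1(1)])
    next
      assume "a1 = \<zero> \<and> d1 = \<zero>"
      hence e: "a = \<delta> \<otimes> a2" "b = \<delta> \<otimes> b2" "c = \<delta> \<otimes> c2" "d = \<delta> \<otimes> d2"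
        using a(3) b(3) c(3) d(3) \<alpha>(3) b\<alpha>'(1) by auto
      have "(\<delta> \<otimes> \<delta>) \<otimes> (a2 \<otimes> b2) = (\<delta> \<otimes> \<delta>) \<otimes> (c2 \<otimes> d2)"
        using eq unfolding e by (simp add: m_ac)
      hence eq2: "a2 \<otimes> b2 = c2 \<otimes> d2"
        using delta_nonzero by (simp add: m_lcancel integral_iff)
      have "a2 \<in> V2 - {\<zero>}" "b2 \<in> V2 - {\<zero>}" "c2 \<in> V2 - {\<zero>}" "d2 \<in> V2 - {\<zero>}"
        using a(2,4) b(2,4) c(2,4) d(2,4) unfolding e by auto
      hence "{a2 <# K, b2 <# K} = {c2 <# K, d2 <# K}"
        using eq2 by (rule sidon_spaceD[OF V2(1)])
      \<comment> \<open>Multiplication by \<delta> transports the equality of cosets from the second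
        components back to the elements.\<close>
      hence "(\<lambda>S. \<delta> <# S) ` {a2 <# K, b2 <# K} = (\<lambda>S. \<delta> <# S) ` {c2 <# K, d2 <# K}"
        by simp
      thus ?thesis
        unfolding e using l_coset_assoc subfieldE(3)[OF K] by simp
    qed
  qed
qed

lemma W_product_cosets:
  assumes "a \<in> W - {\<zero>}" "b \<in> W - {\<zero>}" "c \<in> W - {\<zero>}" "d \<in> W - {\<zero>}"
    and eq: "a \<otimes> b = c \<otimes> d"
  shows "{a <# K, b <# K} = {c <# K, d <# K}"
proof -
  obtain a1 a2 where a: "a1 \<in> V1" "a2 \<in> V2" "a = a1 \<oplus> \<delta> \<otimes> a2" "a \<noteq> \<zero>"
    using assms(1) W_components by blast
  obtain b1 b2 where b: "b1 \<in> V1" "b2 \<in> V2" "b = b1 \<oplus> \<delta> \<otimes> b2" "b \<noteq> \<zero>"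
    using assms(2) W_components by blast
  obtain c1 c2 where c: "c1 \<in> V1" "c2 \<in> V2" "c = c1 \<oplus> \<delta> \<otimes> c2" "c \<noteq> \<zero>"
    using assms(3) W_components by blast
  obtain d1 d2 where d: "d1 \<in> V1" "d2 \<in> V2" "d = d1 \<oplus> \<delta> \<otimes> d2" "d \<noteq> \<zero>"
    using assms(4) W_components by blast
  have inF: "a1 \<in> F" "a2 \<in> F" "b1 \<in> F" "b2 \<in> F" "c1 \<in> F" "c2 \<in> F" "d1 \<in> F" "d2 \<in> F"
    using a b c d V1_F V2_F by auto
  note C = inF[THEN F_carrier]
  \<comment> \<open>The grouping by powers of \<delta> matches \<open>quadratic_unique\<close>, so
    that coefficients can be read off.\<close>
  have expand: "(x1 \<oplus> \<delta> \<otimes> x2) \<otimes> (y1 \<oplus> \<delta> \<otimes> y2)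
      = x1 \<otimes> y1 \<oplus> (\<delta> \<otimes> (x1 \<otimes> y2 \<oplus> x2 \<otimes> y1) \<oplus> \<delta> \<otimes> (\<delta> \<otimes> (x2 \<otimes> y2)))"
    if "x1 \<in> carrier R" "x2 \<in> carrier R" "y1 \<in> carrier R" "y2 \<in> carrier R" for x1 x2 y1 y2
  proof -
    note c = that delta
    have "(x1 \<oplus> \<delta> \<otimes> x2) \<otimes> (y1 \<oplus> \<delta> \<otimes> y2)
        = (x1 \<otimes> y1 \<oplus> (\<delta> \<otimes> x2) \<otimes> y1) \<oplus> (x1 \<otimes> (\<delta> \<otimes> y2) \<oplus> (\<delta> \<otimes> x2) \<otimes> (\<delta> \<otimes> y2))"
      using c by (simp add: l_distr r_distr)
    thus ?thesis using c by (simp add: r_distr a_ac m_ac)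
  qed
  note mem = F_closed(4)[OF inF(1) inF(3)] F_closed(2)[OF F_closed(4)[OF inF(1) inF(4)] F_closed(4)[OF inF(2) inF(3)]]
    F_closed(4)[OF inF(2) inF(4)] F_closed(4)[OF inF(5) inF(7)]
    F_closed(2)[OF F_closed(4)[OF inF(5) inF(8)] F_closed(4)[OF inF(6) inF(7)]] F_closed(4)[OF inF(6) inF(8)]
  have "a1 \<otimes> b1 = c1 \<otimes> d1 \<and> a1 \<otimes> b2 \<oplus> a2 \<otimes> b1 = c1 \<otimes> d2 \<oplus> c2 \<otimes> d1 \<and> a2 \<otimes> b2 = c2 \<otimes> d2"
    using quadratic_unique[OF mem] eq
    unfolding a(3) b(3) c(3) d(3) expand[OF C(1-4)] expand[OF C(5-8)] by blast
  hence "a1 \<otimes> c2 = a2 \<otimes> c1 \<or> b1 \<otimes> c2 = b2 \<otimes> c1"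
    using proportional_of_product_eq[OF C] by simp
  thus ?thesis
  proof
    assume "a1 \<otimes> c2 = a2 \<otimes> c1"
    thus ?thesis by (rule cosets_eq_of_proportional[OF a b c d eq])
  next
    assume "b1 \<otimes> c2 = b2 \<otimes> c1"
    moreover have "a \<in> carrier R" "b \<in> carrier R"
      unfolding a(3) b(3) using C by simp_all
    \<comment> \<open>Commutativity lets \<open>b\<close> take the place of \<open>a\<close>, which
      reduces this alternative to the first.\<close>
    hence "b \<otimes> a = c \<otimes> d"
      unfolding eq[symmetric] by (rule m_comm[symmetric])
    ultimately have "{b <# K, a <# K} = {c <# K, d <# K}"
      by (intro cosets_eq_of_proportional[OF b a c d])
    thus ?thesis by (simp add: insert_commute)
  qed
qed

section \<open>Dimension of \<open>W\<close> and conclusion\<close>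

text \<open>\<open>W\<close> is the direct sum of \<open>V1\<close> and \<open>\<delta> V2\<close>:
  a common element \<open>x = \<delta> y\<close> has two coordinate expressions, which forces
  \<open>x = \<zero>\<close>. Scaling by the nonzero \<delta> keeps the dimension
  \<open>k2\<close>.\<close>

lemma W_dimension:
  assumes "dimension k1 K V1" "dimension k2 K V2"
  shows "dimension (k1 + k2) K W"
proof -
  have "V1 \<inter> (\<delta> <# V2) = {\<zero>}"
  proof
    show "V1 \<inter> (\<delta> <# V2) \<subseteq> {\<zero>}"
    proof
      fix x assume "x \<in> V1 \<inter> (\<delta> <# V2)"
      then obtain y where y: "x \<in> V1" "y \<in> V2" "x = \<delta> \<otimes> y"
        unfolding l_coset_def by auto
      thus "x \<in> {\<zero>}"
        using linear_unique[of x \<zero> \<zero> y] V1_F V2_F F_closed(1) F_carrier by auto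
    qed
    show "{\<zero>} \<subseteq> V1 \<inter> (\<delta> <# V2)"
      using V_zero unfolding l_coset_def by force
  qed
  hence "dimension (k1 + k2) K (V1 <+> (\<delta> <# V2))"
    using dimension_direct_sum_space[OF K assms(1) dimension_l_coset[OF K delta delta_nonzero assms(2)]]
    by simp
  moreover have "V1 <+> (\<delta> <# V2) = W"
    unfolding W_def set_add_def' l_coset_def by auto
  ultimately show ?thesis by simp
qed

lemma W_sidon_space:
  assumes "dimension k1 K V1" "dimension k2 K V2"
  shows "sidon_space R K W"
  \<comment> \<open>Having a finite dimension already includes being a subspace, so no closure
    property of \<open>W\<close> is checked separately.\<close>
  using finite_dimension_imp_subalgebra[OF K finite_dimensionI[OF W_dimension[OF assms]]]
    W_product_cosets
  unfolding sidon_space_def by blast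

end

theorem theorem5p1:
  fixes L :: "('a, 'b) ring_scheme"
    and K F V1 V2 :: "'a set"
    and q n m k1 k2 :: nat
    and p :: "'a list" and \<delta> :: 'a
  assumes "primepow q" and "n > 0"
    and "n dvd m" and "m div n > 2"
    and "field L" and "card (carrier L) = q ^ m"
    and "subfield K L" and "card K = q"
    and "subfield F L" and "card F = q ^ n"
    and "K \<subseteq> F"
    and "sidon_space L K V1" and "V1 \<subseteq> F" and "ring.dimension L k1 K V1"
    and "sidon_space L K V2" and "V2 \<subseteq> F" and "ring.dimension L k2 K V2"
    and "V1 \<noteq> V2"
    and "\<forall>\<alpha> \<in> F - {\<zero>\<^bsub>L\<^esub>}. \<exists>d \<le> 1. ring.dimension L d K (V1 \<inter> (\<alpha> <#\<^bsub>L\<^esub> V2))"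
    and "p \<in> carrier (univ_poly L F)" and "ring_irreducible\<^bsub>univ_poly L F\<^esub> p"
    and "Polynomials.degree p = m div n"
    and "ring.is_root L p \<delta>"
  shows "sidon_space L K {v1 \<oplus>\<^bsub>L\<^esub> \<delta> \<otimes>\<^bsub>L\<^esub> v2 | v1 v2. v1 \<in> V1 \<and> v2 \<in> V2}
       \<and> ring.dimension L (k1 + k2) K {v1 \<oplus>\<^bsub>L\<^esub> \<delta> \<otimes>\<^bsub>L\<^esub> v2 | v1 v2. v1 \<in> V1 \<and> v2 \<in> V2}"
proof -
  interpret L: field L by fact
  have d: "\<delta> \<in> carrier L" "L.eval p \<delta> = \<zero>\<^bsub>L\<^esub>"
    using \<open>ring.is_root L p \<delta>\<close> unfolding L.is_root_def by auto
  have "sidon_pair L K F V1 V2 \<delta>"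
  proof (intro sidon_pair.intro sidon_pair_axioms.intro)
    \<comment> \<open>The degree \<open>m div n\<close> exceeds 2, so no nonzero polynomial over
      \<open>F\<close> of degree at most 2 vanishes at \<delta>.\<close>
    fix u v w
    assume "u \<in> F" "v \<in> F" "w \<in> F"
      "u \<oplus>\<^bsub>L\<^esub> (\<delta> \<otimes>\<^bsub>L\<^esub> v \<oplus>\<^bsub>L\<^esub> \<delta> \<otimes>\<^bsub>L\<^esub> (\<delta> \<otimes>\<^bsub>L\<^esub> w)) = \<zero>\<^bsub>L\<^esub>"
    thus "u = \<zero>\<^bsub>L\<^esub> \<and> v = \<zero>\<^bsub>L\<^esub> \<and> w = \<zero>\<^bsub>L\<^esub>"
      using L.quadratic_independent_of_pirreducible_root[of F p \<delta> u v w] d assms by simp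
  qed (use assms d in auto)
  then interpret S: sidon_pair L K F V1 V2 \<delta> .
  show ?thesis
    using S.W_dimension S.W_sidon_space assms(14,17) unfolding S.W_def by blast
qed

end
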